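(* Let $(M,d)$ be a metric space and let $\mu,\mu_n$ ($n\ge 1$) be probability measures on the Borel $\sigma$-field of $M$. If $\pi(\mu_n,\mu)\to 0$ as $n\to\infty$, then $\mu_n$ converges weakly to $\mu$.
   Context: For $A\subset M$ and $\varepsilon>0$, $A^{\varepsilon}=\{x\in M : \exists\, y\in A \text{ with } d(x,y)<\varepsilon\}$. The Prohorov distance between probability measures $\mu,\nu$ on the Borel $\sigma$-field of $M$ is $$\pi(\mu,\nu)=\inf\{\varepsilon>0 : \mu(A)\le\nu(A^{\varepsilon})+\varepsilon \text{ and } \nu(A)\le\mu(A^{\varepsilon})+\varepsilon \text{ for all closed sets } A\subset M\}.$$ Weak convergence of $\mu_n$ to $\mu$ means $\limsup_{n\to\infty}\mu_n(C)\le\mu(C)$ for every closed set $C\subset M$; equivalently, $\int f\,d\mu_n\to\int f\,d\mu$ for every uniformly continuous $f:M\to[0,1]$. *)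

theory Defs
  imports "HOL-Probability.Probability"
begin

definition open_nbhd :: "'a::metric_space set \<Rightarrow> real \<Rightarrow> 'a set" where
  "open_nbhd A \<epsilon> = {x. \<exists>y\<in>A. dist x y < \<epsilon>}"

text \<open>
  For probability measures the set below contains 1 and is bounded below by 0, so the real-valued
  infimum is the intended one. The enlarged set is open, hence Borel.
\<close>

definition prohorov_dist :: "'a::metric_space measure \<Rightarrow> 'a measure \<Rightarrow> real" where
  "prohorov_dist \<mu> \<nu> = Inf {\<epsilon>. \<epsilon> > 0 \<and>
     (\<forall>A. closed A \<longrightarrow>
        measure \<mu> A \<le> measure \<nu> (open_nbhd A \<epsilon>) + \<epsilon> \<and>
        measure \<nu> A \<le> measure \<mu> (open_nbhd A \<epsilon>) + \<epsilon>)}"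

text \<open>
  The library's \<open>weak_conv_m\<close> is restricted to measures on the real line and defined through
  distribution functions, so weak convergence on a metric space is defined here.
\<close>

definition converges_weakly :: "(nat \<Rightarrow> 'a::metric_space measure) \<Rightarrow> 'a measure \<Rightarrow> bool" where
  "converges_weakly \<mu>s \<mu> \<longleftrightarrow>
     (\<forall>C. closed C \<longrightarrow> limsup (\<lambda>n. ereal (measure (\<mu>s n) C)) \<le> ereal (measure \<mu> C))"

end

theory Submission
  imports Defs
begin

text \<open>Fix a closed \<open>C\<close> and a radius \<delta> > 0. As soon as the Prohorov
  distance drops below \<delta>, the mass of \<open>C\<close> under the n-th measure is at most
  \<mu>(\<open>open_nbhd C\<close> \<delta>) + \<delta> (\<open>prohorov_dist_lessD\<close>), so
  this also bounds the limsup. Now let \<delta> tend to 0: the neighbourhoods shrink to the closure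
  of \<open>C\<close>, which is \<open>C\<close> itself, and continuity from above turns the bound
  into \<mu>(\<open>C\<close>) (\<open>measure_open_nbhd_tendsto\<close>).\<close>

lemma open_open_nbhd: "open (open_nbhd A \<epsilon>)"
proof -
  have "open_nbhd A \<epsilon> = (\<Union>y\<in>A. ball y \<epsilon>)"
    by (auto simp: open_nbhd_def dist_commute)
  then show ?thesis by auto
qed

lemma open_nbhd_mono: "\<epsilon> \<le> \<delta> \<Longrightarrow> open_nbhd A \<epsilon> \<subseteq> open_nbhd A \<delta>"
  unfolding open_nbhd_def by (auto intro: less_le_trans)

text \<open>Radii 1/(n+1) suffice by the Archimedean property; a countable family is what continuity
  of measure can handle.\<close>

lemma INT_open_nbhd: "(\<Inter>n. open_nbhd A (inverse (real (Suc n)))) = closure A"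
proof (intro equalityI subsetI)
  fix x assume x: "x \<in> (\<Inter>n. open_nbhd A (inverse (real (Suc n))))"
  show "x \<in> closure A"
    unfolding closure_approachable
  proof (intro allI impI)
    fix e :: real assume "e > 0"
    then obtain n where n: "inverse (real (Suc n)) < e"
      using reals_Archimedean by blast
    from x obtain y where "y \<in> A" "dist x y < inverse (real (Suc n))"
      unfolding open_nbhd_def by blast
    with n show "\<exists>y\<in>A. dist y x < e"
      by (metis dist_commute less_trans)
  qed
next
  fix x assume "x \<in> closure A"
  then show "x \<in> (\<Inter>n. open_nbhd A (inverse (real (Suc n))))"
    by (auto simp: open_nbhd_def closure_approachable dist_commute)
qed

lemma measure_open_nbhd_tendsto:
  fixes \<mu> :: "'a::metric_space measure"
  assumes "finite_measure \<mu>" and sets: "sets \<mu> = sets borel" and "closed C"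
  shows "(\<lambda>n. measure \<mu> (open_nbhd C (inverse (real (Suc n))))) \<longlonglongrightarrow> measure \<mu> C"
proof -
  interpret finite_measure \<mu> by fact
  have "range (\<lambda>n. open_nbhd C (inverse (real (Suc n)))) \<subseteq> sets \<mu>"
    using sets by (auto intro: borel_open open_open_nbhd)
  moreover have "decseq (\<lambda>n. open_nbhd C (inverse (real (Suc n))))"
    unfolding decseq_def by (intro allI impI open_nbhd_mono) simp
  ultimately have "(\<lambda>n. measure \<mu> (open_nbhd C (inverse (real (Suc n)))))
      \<longlonglongrightarrow> measure \<mu> (\<Inter>n. open_nbhd C (inverse (real (Suc n))))"
    by (rule finite_Lim_measure_decseq)
  then show ?thesis
    unfolding INT_open_nbhd closure_closed[OF \<open>closed C\<close>] .
qed

text \<open>The infimum need not be attained, but a value strictly below \<delta> leaves room for an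
  admissible \<epsilon> < \<delta>, and the right-hand side grows with the radius.\<close>

lemma prohorov_dist_lessD:
  fixes \<mu> \<nu> :: "'a::metric_space measure"
  assumes "prob_space \<mu>" and "prob_space \<nu>" and sets: "sets \<nu> = sets borel"
    and less: "prohorov_dist \<mu> \<nu> < \<delta>" and "closed A"
  shows "measure \<mu> A \<le> measure \<nu> (open_nbhd A \<delta>) + \<delta>"
proof -
  interpret M: prob_space \<mu> by fact
  interpret N: prob_space \<nu> by fact
  let ?S = "{\<epsilon>. \<epsilon> > 0 \<and> (\<forall>A. closed A \<longrightarrow>
        measure \<mu> A \<le> measure \<nu> (open_nbhd A \<epsilon>) + \<epsilon> \<and>
        measure \<nu> A \<le> measure \<mu> (open_nbhd A \<epsilon>) + \<epsilon>)}"
  \<comment> \<open>Probabilities never exceed 1. Nonemptiness matters: the real \<open>Inf\<close>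
    says nothing useful on the empty set.\<close>
  have "1 \<in> ?S"
    by (auto intro: add_increasing)
  then have "?S \<noteq> {}" by blast
  with less obtain \<epsilon> where "\<epsilon> \<in> ?S" and "\<epsilon> < \<delta>"
    unfolding prohorov_dist_def by (meson cInf_lessD)
  with \<open>closed A\<close> have "measure \<mu> A \<le> measure \<nu> (open_nbhd A \<epsilon>) + \<epsilon>"
    by blast
  also have "\<dots> \<le> measure \<nu> (open_nbhd A \<delta>) + \<delta>"
    using \<open>\<epsilon> < \<delta>\<close> sets
    by (intro add_mono N.finite_measure_mono open_nbhd_mono) (auto intro: borel_open open_open_nbhd)
  finally show ?thesis .
qed

theorem theorem1p6:
  fixes \<mu> :: "'a::metric_space measure" and \<mu>s :: "nat \<Rightarrow> 'a measure"
  assumes "prob_space \<mu>" and "sets \<mu> = sets borel"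
    and "\<And>n. n \<ge> 1 \<Longrightarrow> prob_space (\<mu>s n)"
    and "\<And>n. n \<ge> 1 \<Longrightarrow> sets (\<mu>s n) = sets borel"
    and "(\<lambda>n. prohorov_dist (\<mu>s n) \<mu>) \<longlonglongrightarrow> 0"
  shows "converges_weakly \<mu>s \<mu>"
  unfolding converges_weakly_def
proof (intro allI impI)
  fix C :: "'a set" assume C: "closed C"
  interpret prob_space \<mu> by fact
  define \<delta> where "\<delta> k = inverse (real (Suc k))" for k
  \<comment> \<open>The radius stays fixed while n grows; only afterwards does k tend to
    infinity.\<close>
  have bound: "limsup (\<lambda>n. ereal (measure (\<mu>s n) C)) \<le> ereal (measure \<mu> (open_nbhd C (\<delta> k)) + \<delta> k)"
    for k
  proof (rule Limsup_bounded)
    have "\<forall>\<^sub>F n in sequentially. prohorov_dist (\<mu>s n) \<mu> < \<delta> k"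
      using assms(5) by (rule order_tendstoD) (simp add: \<delta>_def)
    then show "\<forall>\<^sub>F n in sequentially.
        ereal (measure (\<mu>s n) C) \<le> ereal (measure \<mu> (open_nbhd C (\<delta> k)) + \<delta> k)"
      \<comment> \<open>Index 0 is discarded, since \<open>\<mu>s 0\<close> is not assumed to be a
        probability measure.\<close>
      using eventually_ge_at_top[of 1]
      by eventually_elim (use assms C in \<open>auto intro: prohorov_dist_lessD\<close>)
  qed
  have "(\<lambda>k. measure \<mu> (open_nbhd C (\<delta> k)) + \<delta> k) \<longlonglongrightarrow> measure \<mu> C + 0"
    unfolding \<delta>_def
    by (intro tendsto_add measure_open_nbhd_tendsto LIMSEQ_inverse_real_of_nat
        finite_measure_axioms assms(2) C)
  then have "(\<lambda>k. ereal (measure \<mu> (open_nbhd C (\<delta> k)) + \<delta> k)) \<longlonglongrightarrow> ereal (measure \<mu> C)"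
    by simp
  \<comment> \<open>The limsup does not depend on k and lies below every term of a sequence
    converging to the right-hand side.\<close>
  then show "limsup (\<lambda>n. ereal (measure (\<mu>s n) C)) \<le> ereal (measure \<mu> C)"
    by (rule LIMSEQ_le_const) (use bound in blast)
qed

end
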